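(* Let $M=(E,\mathcal I)$ be a finite matroid with rank function $\rho$ and $|E|=n$, let $f\in\mathrm{Hom}_d(n)$, let $e\in E$, and let $s:E\to\Omega=\{1,\dots,n\}$ be a label of $M$. Then: (a) $T_f(\emptyset;x,y)=\widetilde f(\emptyset)$, where $\emptyset$ (as argument of $T_f$) is the empty matroid. (b) If $e$ is a loop, then $T_f(M(s);x,y)=T_f(M(s)\backslash e;x,y)+(y-1)\,\widetilde f(s(e))\circ T_f(M(s)\backslash e;x,y)$. (c) If $e$ is a coloop, then $T_f(M(s);x,y)=(x-1)\,T_f(M(s)/e;x,y)+\widetilde f(s(e))\circ T_f(M(s)/e;x,y)$. (d) If $e$ is neither a loop nor a coloop, then $T_f(M(s);x,y)=T_f(M(s)\backslash e;x,y)+\widetilde f(s(e))\circ T_f(M(s)/e;x,y)$.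
   Context: Let $\Omega=\{1,\dots,n\}$ and $\Omega_d=\{Z\subset\Omega:|Z|=d\}$. $\mathrm{Hom}_d(n)$ is the real vector space of formal sums $f=\sum_{Z\in\Omega_d}f(Z)Z$, identified with functions $f:\Omega_d\to\mathbb R$. For $X\subset\Omega$ put $\widetilde f(X)=\sum_{Z\in\Omega_d,\,Z\subset X}f(Z)$. A label of a matroid $M$ with ground set $E$, $|E|=n$, is a bijection $s:E\to\Omega$; $M(s)$ denotes $M$ with ground set indexed by $s$. The weighted Tutte polynomial is $$T_f(M(s);x,y)=\sum_{A\subset E}\widetilde f(s(A))(x-1)^{\rho(E)-\rho(A)}(y-1)^{|A|-\rho(A)}.$$ An element $e$ is a loop if $\rho(\{e\})=0$, and a coloop if it lies in every basis. $M\backslash e$ (deletion) and $M/e$ (contraction) are the usual matroids on $E\setminus\{e\}$. $M(s)\backslash e$ and $M(s)/e$ are labelled by the restriction of $s$ (an injective map into the same $\Omega$), and $T_f$ of such minors is given by the same formula with the same $f$, the ground set and rank function being those of the minor (this also applies to the empty matroid in (a)). Operator $\circ$: $\widetilde f(X)\circ\widetilde f(Y):=\widetilde f(X\cup Y)$, extended distributively over sums and scalar (polynomial) multiples. It acts on expressions regarded as formal linear combinations of the symbols $\widetilde f(Y)$, $Y\subset\Omega$; with $\widetilde f(s(e))=\widetilde f(\{s(e)\})$, the operation $\widetilde f(s(e))\circ$ replaces each symbol $\widetilde f(Y)$ by $\widetilde f(Y\cup\{s(e)\})$. *)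

theory Defs
  imports
    "HOL-Computational_Algebra.Polynomial"
    "HOL-Library.Poly_Mapping"
begin

section \<open>Matroids\<close>

record 'a matroid =
  ground :: "'a set"
  indep :: "'a set set"

definition is_matroid :: "'a matroid \<Rightarrow> bool" where
  "is_matroid M \<longleftrightarrow>
     finite (ground M) \<and>
     indep M \<subseteq> Pow (ground M) \<and>
     {} \<in> indep M \<and>
     (\<forall>I J. I \<in> indep M \<longrightarrow> J \<subseteq> I \<longrightarrow> J \<in> indep M) \<and>
     (\<forall>I J. I \<in> indep M \<longrightarrow> J \<in> indep M \<longrightarrow> card J < card I \<longrightarrow>
        (\<exists>x\<in>I - J. insert x J \<in> indep M))"

definition rank :: "'a matroid \<Rightarrow> 'a set \<Rightarrow> nat" where
  "rank M A = Max (card ` {I \<in> indep M. I \<subseteq> A})"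

definition is_basis :: "'a matroid \<Rightarrow> 'a set \<Rightarrow> bool" where
  "is_basis M B \<longleftrightarrow> B \<in> indep M \<and> (\<forall>I\<in>indep M. B \<subseteq> I \<longrightarrow> I = B)"

definition is_loop :: "'a matroid \<Rightarrow> 'a \<Rightarrow> bool" where
  "is_loop M e \<longleftrightarrow> e \<in> ground M \<and> rank M {e} = 0"

definition is_coloop :: "'a matroid \<Rightarrow> 'a \<Rightarrow> bool" where
  "is_coloop M e \<longleftrightarrow> e \<in> ground M \<and> (\<forall>B. is_basis M B \<longrightarrow> e \<in> B)"

definition deletion :: "'a matroid \<Rightarrow> 'a \<Rightarrow> 'a matroid" where
  "deletion M e = \<lparr>ground = ground M - {e},
                   indep = {I \<in> indep M. I \<subseteq> ground M - {e}}\<rparr>"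

text \<open>Contracting a loop is the same as deleting it.\<close>

definition contraction :: "'a matroid \<Rightarrow> 'a \<Rightarrow> 'a matroid" where
  "contraction M e =
     (if is_loop M e then deletion M e
      else \<lparr>ground = ground M - {e},
            indep = {I. I \<subseteq> ground M - {e} \<and> insert e I \<in> indep M}\<rparr>)"

definition empty_matroid :: "'a matroid" where
  "empty_matroid = \<lparr>ground = {}, indep = {{}}\<rparr>"


section \<open>The spaces \<open>Hom\<^sub>d(n)\<close>\<close>

definition Omega :: "nat \<Rightarrow> nat \<Rightarrow> nat set set" where
  "Omega n d = {Z. Z \<subseteq> {1..n} \<and> card Z = d}"

definition Hom :: "nat \<Rightarrow> nat \<Rightarrow> (nat set \<Rightarrow>\<^sub>0 real) set" where
  "Hom d n = {f. Poly_Mapping.keys f \<subseteq> Omega n d}"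

definition tilde :: "nat \<Rightarrow> nat \<Rightarrow> (nat set \<Rightarrow>\<^sub>0 real) \<Rightarrow> nat set \<Rightarrow> real" where
  "tilde n d f X = (\<Sum>Z | Z \<in> Omega n d \<and> Z \<subseteq> X. Poly_Mapping.lookup f Z)"


section \<open>The weighted Tutte polynomial\<close>

text \<open>
  Polynomials in \<open>x\<close> and \<open>y\<close> are polynomials in \<open>y\<close> whose coefficients are
  polynomials in \<open>x\<close>.
\<close>

type_synonym bipoly = "real poly poly"

definition var_x :: bipoly where "var_x = [:[:0, 1:]:]"
definition var_y :: bipoly where "var_y = [:0, 1:]"
definition const :: "real \<Rightarrow> bipoly" where "const c = [:[:c:]:]"

text \<open>
  The coefficient belonging to a subset \<open>A\<close> of the ground set; in a matroid neither
  of the natural-number subtractions truncates.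
\<close>

definition tutte_coeff :: "'a matroid \<Rightarrow> 'a set \<Rightarrow> bipoly" where
  "tutte_coeff M A =
     (var_x - 1) ^ (rank M (ground M) - rank M A) * (var_y - 1) ^ (card A - rank M A)"

text \<open>
  Only the values of the label \<open>s\<close> on the ground set of \<open>M\<close> matter, so a minor of
  \<open>M\<close> labelled by the restriction of \<open>s\<close> is represented by the minor together with
  \<open>s\<close> itself.
\<close>

definition wtutte ::
  "nat \<Rightarrow> nat \<Rightarrow> (nat set \<Rightarrow>\<^sub>0 real) \<Rightarrow> 'a matroid \<Rightarrow> ('a \<Rightarrow> nat) \<Rightarrow> bipoly" where
  "wtutte n d f M s = (\<Sum>A\<in>Pow (ground M). const (tilde n d f (s ` A)) * tutte_coeff M A)"


section \<open>Formal expressions and the operator \<open>\<circ>\<close>\<close>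

text \<open>
  The operator \<open>\<circ>\<close> is not well defined on polynomials, only on formal linear
  combinations, with polynomial coefficients, of symbols indexed by sets \<open>Y\<close>.  The
  symbol of \<open>Y\<close> stands for the value \<open>tilde n d f Y\<close>; \<open>expr_val\<close> substitutes it.
\<close>

type_synonym expr = "nat set \<Rightarrow>\<^sub>0 bipoly"

definition symb :: "nat set \<Rightarrow> expr" where
  "symb Y = Poly_Mapping.single Y 1"

definition circ :: "expr \<Rightarrow> expr \<Rightarrow> expr" (infixr "\<odot>" 75) where
  "p \<odot> q = (\<Sum>X\<in>Poly_Mapping.keys p. \<Sum>Y\<in>Poly_Mapping.keys q.
     Poly_Mapping.single (X \<union> Y) (Poly_Mapping.lookup p X * Poly_Mapping.lookup q Y))"

definition expr_val :: "nat \<Rightarrow> nat \<Rightarrow> (nat set \<Rightarrow>\<^sub>0 real) \<Rightarrow> expr \<Rightarrow> bipoly" where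
  "expr_val n d f p =
     (\<Sum>Y\<in>Poly_Mapping.keys p. const (tilde n d f Y) * Poly_Mapping.lookup p Y)"

text \<open>The defining sum of \<open>wtutte\<close>, read as a formal expression.\<close>

definition wtutte_expr :: "'a matroid \<Rightarrow> ('a \<Rightarrow> nat) \<Rightarrow> expr" where
  "wtutte_expr M s = (\<Sum>A\<in>Pow (ground M). Poly_Mapping.single (s ` A) (tutte_coeff M A))"

lemma expr_val_superset:
  assumes "finite K" "Poly_Mapping.keys p \<subseteq> K"
  shows "expr_val n d f p = (\<Sum>Y\<in>K. const (tilde n d f Y) * Poly_Mapping.lookup p Y)"
  unfolding expr_val_def
  by (rule sum.mono_neutral_left) (use assms in \<open>auto simp: in_keys_iff\<close>)

lemma expr_val_zero [simp]: "expr_val n d f 0 = 0"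
  by (simp add: expr_val_def)

lemma expr_val_single [simp]:
  "expr_val n d f (Poly_Mapping.single Y c) = const (tilde n d f Y) * c"
  by (subst expr_val_superset[of "{Y}"]) auto

lemma expr_val_add: "expr_val n d f (p + q) = expr_val n d f p + expr_val n d f q"
proof -
  let ?K = "Poly_Mapping.keys p \<union> Poly_Mapping.keys q"
  have K: "finite ?K" "Poly_Mapping.keys (p + q) \<subseteq> ?K"
    by (simp_all add: Poly_Mapping.keys_add)
  show ?thesis
    using expr_val_superset[OF K, of n d f] expr_val_superset[of ?K p n d f]
      expr_val_superset[of ?K q n d f]
    by (simp add: lookup_add distrib_left sum.distrib)
qed

lemma expr_val_sum: "expr_val n d f (\<Sum>i\<in>I. p i) = (\<Sum>i\<in>I. expr_val n d f (p i))"
  by (induction I rule: infinite_finite_induct) (simp_all add: expr_val_add)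

lemma expr_val_wtutte_expr: "expr_val n d f (wtutte_expr M s) = wtutte n d f M s"
  by (simp add: wtutte_expr_def wtutte_def expr_val_sum)

lemma symb_circ_symb: "symb X \<odot> symb Y = symb (X \<union> Y)"
  by (simp add: circ_def symb_def)

end

theory Submission
  imports Defs
begin

text \<open>
  Split the subsets of the ground set into the sets \<open>A\<close> avoiding \<open>e\<close> and the sets
  \<open>insert e A\<close>.  The sets \<open>A\<close> contribute the unmodified weights \<open>s ` A\<close>, the sets
  \<open>insert e A\<close> exactly the weights produced by \<open>symb {s e} \<odot> _\<close>, and the rank function
  of the minor tells by which power of \<open>x - 1\<close> or \<open>y - 1\<close> the coefficients change.
\<close>

section \<open>Rank functions of minors\<close>

context
  fixes M :: "'a matroid"
  assumes M: "is_matroid M"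
begin

lemma finite_ground: "finite (ground M)"
  and indep_subset_ground: "I \<in> indep M \<Longrightarrow> I \<subseteq> ground M"
  and empty_indep: "{} \<in> indep M"
  and indep_subset: "I \<in> indep M \<Longrightarrow> J \<subseteq> I \<Longrightarrow> J \<in> indep M"
  and indep_augment: "I \<in> indep M \<Longrightarrow> J \<in> indep M \<Longrightarrow> card J < card I \<Longrightarrow>
    \<exists>x\<in>I - J. insert x J \<in> indep M"
  using M unfolding is_matroid_def by blast+

lemma finite_indep: "I \<in> indep M \<Longrightarrow> finite I"
  using finite_ground indep_subset_ground finite_subset by blast

lemma finite_indep_subsets: "finite {I \<in> indep M. I \<subseteq> A}"
  by (rule finite_subset[of _ "Pow (ground M)"])
    (auto dest: indep_subset_ground simp: finite_ground)

section \<open>Rank as the size of a largest independent subset, and extension of independent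
  sets\<close>

lemma card_le_rank: "I \<in> indep M \<Longrightarrow> I \<subseteq> A \<Longrightarrow> card I \<le> rank M A"
  unfolding rank_def using finite_indep_subsets by (intro Max_ge) auto

lemma rank_attained:
  obtains I where "I \<in> indep M" "I \<subseteq> A" "card I = rank M A"
proof -
  have "rank M A \<in> card ` {I \<in> indep M. I \<subseteq> A}"
    unfolding rank_def
    by (rule Max_in) (use finite_indep_subsets[of A] empty_indep in auto)
  then show ?thesis using that by auto
qed

lemma rank_mono: "A \<subseteq> B \<Longrightarrow> rank M A \<le> rank M B"
  using rank_attained[of A] card_le_rank[of _ B] by (metis subset_trans)

lemma rank_le_card: "finite A \<Longrightarrow> rank M A \<le> card A"
  using rank_attained[of A] by (metis card_mono)

lemma rank_insert_le: "rank M (insert e A) \<le> Suc (rank M A)"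
proof -
  obtain I where I: "I \<in> indep M" "I \<subseteq> insert e A" "card I = rank M (insert e A)"
    by (rule rank_attained)
  have "card (I - {e}) \<le> rank M A"
    using I by (intro card_le_rank indep_subset[OF I(1)]) auto
  moreover have "card I \<le> Suc (card (I - {e}))"
    using finite_indep[OF I(1)] by (cases "e \<in> I") (simp_all add: card_Suc_Diff1)
  ultimately show ?thesis using I(3) by linarith
qed

text \<open>As long as \<open>J\<close> is too small, augmentation from a maximum independent subset
  of \<open>A\<close> adds an element of \<open>A\<close> to it. This yields full-size independent
  sets through a prescribed start, as needed for bases, coloops and contraction.\<close>

lemma indep_extend:
  assumes "J \<in> indep M" "J \<subseteq> A"
  obtains K where "K \<in> indep M" "J \<subseteq> K" "K \<subseteq> A" "card K = rank M A"
proof -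
  have "\<exists>K\<in>indep M. J \<subseteq> K \<and> K \<subseteq> A \<and> card K = rank M A"
    using assms
  proof (induction "rank M A - card J" arbitrary: J rule: less_induct)
    case less
    obtain I where I: "I \<in> indep M" "I \<subseteq> A" "card I = rank M A"
      by (rule rank_attained)
    show ?case
    proof (cases "card J = rank M A")
      case True
      then show ?thesis using less.prems by blast
    next
      case False
      then have lt: "card J < card I"
        using card_le_rank[OF less.prems] I(3) by linarith
      then obtain x where x: "x \<in> I - J" "insert x J \<in> indep M"
        using indep_augment[OF I(1) less.prems(1)] by blast
      have "card (insert x J) = Suc (card J)"
        using x(1) finite_indep[OF less.prems(1)] by simp
      then have "\<exists>K\<in>indep M. insert x J \<subseteq> K \<and> K \<subseteq> A \<and> card K = rank M A"
        using x I lt less.prems(2) by (intro less.hyps) auto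
      then show ?thesis by blast
    qed
  qed
  then show ?thesis using that by blast
qed

text \<open>A set maximal under inclusion cannot be smaller than the rank, since it would extend; a
  set of full rank has no larger independent superset by the rank bound.\<close>

lemma is_basis_iff_card:
  "is_basis M B \<longleftrightarrow> B \<in> indep M \<and> card B = rank M (ground M)"
proof
  assume B: "is_basis M B"
  then have ind: "B \<in> indep M"
    and max: "\<And>I. I \<in> indep M \<Longrightarrow> B \<subseteq> I \<Longrightarrow> I = B"
    unfolding is_basis_def by blast+
  from indep_extend[OF ind indep_subset_ground[OF ind]] max ind
  show "B \<in> indep M \<and> card B = rank M (ground M)" by metis
next
  assume B: "B \<in> indep M \<and> card B = rank M (ground M)"
  have "I = B" if I: "I \<in> indep M" "B \<subseteq> I" for I
    using card_seteq[OF finite_indep[OF I(1)] I(2)]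
      card_le_rank[OF I(1) indep_subset_ground[OF I(1)]] B by simp
  then show "is_basis M B" using B unfolding is_basis_def by blast
qed

section \<open>Loops and coloops in terms of independence and rank\<close>

lemma is_loop_iff:
  assumes "e \<in> ground M"
  shows "is_loop M e \<longleftrightarrow> {e} \<notin> indep M"
proof
  assume "is_loop M e"
  then show "{e} \<notin> indep M"
    using card_le_rank[of "{e}" "{e}"] unfolding is_loop_def by auto
next
  assume ne: "{e} \<notin> indep M"
  obtain I where "I \<in> indep M" "I \<subseteq> {e}" "card I = rank M {e}"
    by (rule rank_attained)
  moreover from this ne have "I = {}" by (metis subset_singletonD)
  ultimately show "is_loop M e" using assms unfolding is_loop_def by simp
qed

lemma rank_insert_loop:
  assumes "is_loop M e"
  shows "rank M (insert e A) = rank M A"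
proof (rule antisym)
  obtain I where I: "I \<in> indep M" "I \<subseteq> insert e A" "card I = rank M (insert e A)"
    by (rule rank_attained)
  have "{e} \<notin> indep M"
    using is_loop_iff[of e] assms unfolding is_loop_def by blast
  then have "e \<notin> I" using indep_subset[OF I(1), of "{e}"] by blast
  then show "rank M (insert e A) \<le> rank M A"
    using I card_le_rank[of I A] by auto
qed (auto intro: rank_mono)

text \<open>Some basis exists and contains \<open>e\<close>, so \<open>{e}\<close> is independent.
  This selects the non-loop branch of \<open>contraction\<close> in the coloop case.\<close>

lemma coloop_not_loop:
  assumes "is_coloop M e"
  shows "\<not> is_loop M e"
proof -
  obtain B where "B \<in> indep M" "card B = rank M (ground M)"
    by (rule rank_attained)
  then show ?thesis
    using assms is_loop_iff[of e] is_basis_iff_card[of B] indep_subset[of B "{e}"]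
    unfolding is_coloop_def by blast
qed

text \<open>A maximum independent subset of \<open>A\<close> extends to a basis. The basis contains
  \<open>e\<close>, so adding \<open>e\<close> to the subset keeps it independent.\<close>

lemma rank_insert_coloop:
  assumes "is_coloop M e" "A \<subseteq> ground M - {e}"
  shows "rank M (insert e A) = Suc (rank M A)"
proof (rule antisym[OF rank_insert_le])
  obtain I where I: "I \<in> indep M" "I \<subseteq> A" "card I = rank M A"
    by (rule rank_attained)
  obtain B where B: "B \<in> indep M" "I \<subseteq> B" "card B = rank M (ground M)"
    by (rule indep_extend[OF I(1) indep_subset_ground[OF I(1)]])
  then have "e \<in> B" using assms(1) is_basis_iff_card unfolding is_coloop_def by blast
  then have "insert e I \<in> indep M" using B by (intro indep_subset[OF B(1)]) auto
  moreover have "card (insert e I) = Suc (card I)"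
    using I assms(2) finite_indep by (subst card_insert_disjoint) auto
  ultimately show "Suc (rank M A) \<le> rank M (insert e A)"
    using card_le_rank[of "insert e I" "insert e A"] I by auto
qed

text \<open>A basis avoiding \<open>e\<close> survives in the complement of \<open>e\<close> and has
  full rank.\<close>

lemma rank_ground_minus_non_coloop:
  assumes "e \<in> ground M" "\<not> is_coloop M e"
  shows "rank M (ground M - {e}) = rank M (ground M)"
proof (rule antisym)
  obtain B where "is_basis M B" "e \<notin> B"
    using assms unfolding is_coloop_def by blast
  then have B: "B \<in> indep M" "card B = rank M (ground M)" "e \<notin> B"
    using is_basis_iff_card by blast+
  then show "rank M (ground M) \<le> rank M (ground M - {e})"
    using card_le_rank[of B "ground M - {e}"] indep_subset_ground[of B] by auto
qed (auto intro: rank_mono)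

section \<open>Ranks in the deletion and the contraction\<close>

lemma rank_deletion:
  assumes "A \<subseteq> ground M - {e}"
  shows "rank (deletion M e) A = rank M A"
proof -
  have "{I \<in> indep (deletion M e). I \<subseteq> A} = {I \<in> indep M. I \<subseteq> A}"
    using assms unfolding deletion_def by auto
  then show ?thesis unfolding rank_def by simp
qed

text \<open>Adding \<open>e\<close> turns independent sets of the contraction into independent sets
  of \<open>M\<close> that are larger by one. The equation is additive, which avoids truncated
  subtraction.\<close>

lemma rank_contraction:
  assumes e: "e \<in> ground M" "\<not> is_loop M e" and A: "A \<subseteq> ground M - {e}"
  shows "rank M (insert e A) = Suc (rank (contraction M e) A)"
proof -
  let ?S = "{I. I \<subseteq> A \<and> insert e I \<in> indep M}"
  have S: "{I \<in> indep (contraction M e). I \<subseteq> A} = ?S"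
    using e A unfolding contraction_def by auto
  have fin: "finite ?S"
    by (rule finite_subset[of _ "Pow (ground M)"]) (use A finite_ground in auto)
  have card: "card (insert e I) = Suc (card I)" if "I \<in> ?S" for I
    using that A finite_subset[OF _ finite_indep, of I "insert e I"]
    by (subst card_insert_disjoint) auto
  \<comment> \<open>A maximum independent subset of \<open>insert e A\<close> can be chosen through
    \<open>e\<close>, because \<open>{e}\<close> is independent; \<open>K - {e}\<close> then attains
    the contracted rank.\<close>
  obtain K where K: "K \<in> indep M" "{e} \<subseteq> K" "K \<subseteq> insert e A"
      "card K = rank M (insert e A)"
    by (rule indep_extend[of "{e}" "insert e A"]) (use e is_loop_iff[of e] in auto)
  then have KS: "K - {e} \<in> ?S" by (auto simp: insert_absorb)
  have "Max (card ` ?S) = card (K - {e})"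
  proof (rule Max_eqI)
    fix k assume "k \<in> card ` ?S"
    then obtain I where I: "I \<in> ?S" "k = card I" by blast
    then have "card (insert e I) \<le> card K"
      using card_le_rank[of "insert e I" "insert e A"] K(4) by auto
    then show "k \<le> card (K - {e})"
      using card[OF I(1)] card[OF KS] K(2) I(2) by (simp add: insert_absorb)
  qed (use fin KS in auto)
  then have "rank (contraction M e) A = card (K - {e})"
    unfolding rank_def S .
  then show ?thesis using card[OF KS] K by (simp add: insert_absorb)
qed

end

lemma ground_deletion [simp]: "ground (deletion M e) = ground M - {e}"
  by (simp add: deletion_def)

lemma ground_contraction [simp]: "ground (contraction M e) = ground M - {e}"
  by (simp add: contraction_def)

section \<open>Coefficients of minors\<close>

text \<open>Adding a loop raises the cardinality but no rank, so only the exponent of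
  \<open>var_y - 1\<close> grows, by one.\<close>

lemma tutte_coeff_deletion_loop:
  assumes "is_matroid M" "is_loop M e" "A \<subseteq> ground M - {e}"
  shows "tutte_coeff M A = tutte_coeff (deletion M e) A"
    and "tutte_coeff M (insert e A) = (var_y - 1) * tutte_coeff (deletion M e) A"
proof -
  have "insert e (ground M - {e}) = ground M"
    using assms(2) unfolding is_loop_def by auto
  then have r: "rank M (ground M) = rank (deletion M e) (ground M - {e})"
    using rank_insert_loop[OF assms(1,2), of "ground M - {e}"]
      rank_deletion[OF assms(1), of "ground M - {e}" e] by simp
  have rA: "rank M A = rank (deletion M e) A"
    using rank_deletion[OF assms(1,3)] by simp
  show "tutte_coeff M A = tutte_coeff (deletion M e) A"
    unfolding tutte_coeff_def by (simp add: r rA)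
  have "finite A"
    using assms(3) finite_ground[OF assms(1)] finite_subset by blast
  \<comment> \<open>The bound of the rank by the cardinality ensures that the subtraction does not
    truncate.\<close>
  then have "card (insert e A) - rank M A = Suc (card A - rank M A)"
    using assms(3) rank_le_card[OF assms(1), of A]
    by (subst card_insert_disjoint) (auto simp: Suc_diff_le)
  then show "tutte_coeff M (insert e A) = (var_y - 1) * tutte_coeff (deletion M e) A"
    unfolding tutte_coeff_def rank_insert_loop[OF assms(1,2)] by (simp add: r rA)
qed

text \<open>Contraction lowers both ranks and the cardinality by one, so the differences in both
  exponents are unchanged.\<close>

lemma tutte_coeff_insert_contraction:
  assumes "is_matroid M" "e \<in> ground M" "\<not> is_loop M e" "A \<subseteq> ground M - {e}"
  shows "tutte_coeff M (insert e A) = tutte_coeff (contraction M e) A"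
proof -
  have "finite A" "e \<notin> A"
    using assms(4) finite_ground[OF assms(1)] finite_subset by blast+
  moreover have "rank M (ground M) = Suc (rank (contraction M e) (ground M - {e}))"
    using rank_contraction[OF assms(1-3), of "ground M - {e}"] assms(2)
    by (simp add: insert_absorb)
  ultimately show ?thesis
    unfolding tutte_coeff_def by (simp add: rank_contraction[OF assms])
qed

text \<open>On sets avoiding a coloop, the contraction has the rank function of \<open>M\<close>;
  only the rank of the whole ground set drops, which costs one factor
  \<open>var_x - 1\<close>.\<close>

lemma tutte_coeff_contraction_coloop:
  assumes M: "is_matroid M" and e: "is_coloop M e" and A: "A \<subseteq> ground M - {e}"
  shows "tutte_coeff M A = (var_x - 1) * tutte_coeff (contraction M e) A"
proof -
  have eM: "e \<in> ground M" using e unfolding is_coloop_def by blast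
  have r: "rank M B = rank (contraction M e) B" if "B \<subseteq> ground M - {e}" for B
    using rank_contraction[OF M eM coloop_not_loop[OF M e] that]
      rank_insert_coloop[OF M e that] by simp
  have "rank M (ground M) = Suc (rank M (ground M - {e}))"
    using rank_insert_coloop[OF M e, of "ground M - {e}"] eM
    by (simp add: insert_absorb)
  moreover have "rank M A \<le> rank M (ground M - {e})"
    using rank_mono[OF M A] .
  ultimately show ?thesis
    unfolding tutte_coeff_def by (simp add: r[OF A] r[OF subset_refl] Suc_diff_le)
qed

lemma tutte_coeff_deletion_non_coloop:
  assumes "is_matroid M" "e \<in> ground M" "\<not> is_coloop M e" "A \<subseteq> ground M - {e}"
  shows "tutte_coeff M A = tutte_coeff (deletion M e) A"
  using rank_ground_minus_non_coloop[OF assms(1-3)] rank_deletion[OF assms(1)] assms(4)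
  unfolding tutte_coeff_def by simp

section \<open>Expansion of the weighted Tutte polynomial\<close>

text \<open>Distinct keys \<open>Y\<close> may have the same union with \<open>X\<close>. Summing
  over the keys of \<open>p\<close> avoids collecting merged coefficients, and the free superset
  \<open>K\<close> lets several expressions share an index set.\<close>

lemma expr_val_symb_circ:
  assumes "finite K" "Poly_Mapping.keys p \<subseteq> K"
  shows "expr_val n d f (symb X \<odot> p) =
    (\<Sum>Y\<in>K. const (tilde n d f (X \<union> Y)) * Poly_Mapping.lookup p Y)"
proof -
  have "expr_val n d f (symb X \<odot> p) =
      (\<Sum>Y\<in>Poly_Mapping.keys p. const (tilde n d f (X \<union> Y)) * Poly_Mapping.lookup p Y)"
    by (simp add: circ_def symb_def expr_val_sum)
  also have "\<dots> = (\<Sum>Y\<in>K. const (tilde n d f (X \<union> Y)) * Poly_Mapping.lookup p Y)"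
    by (rule sum.mono_neutral_left) (use assms in \<open>auto simp: in_keys_iff\<close>)
  finally show ?thesis .
qed

lemma expr_val_symb_circ_single:
  "expr_val n d f (symb X \<odot> Poly_Mapping.single Y c) = const (tilde n d f (X \<union> Y)) * c"
  by (subst expr_val_symb_circ[of "{Y}"]) auto

lemma expr_val_symb_circ_add:
  "expr_val n d f (symb X \<odot> (p + q)) =
    expr_val n d f (symb X \<odot> p) + expr_val n d f (symb X \<odot> q)"
proof -
  let ?K = "Poly_Mapping.keys p \<union> Poly_Mapping.keys q"
  have K: "finite ?K" "Poly_Mapping.keys (p + q) \<subseteq> ?K"
    by (simp_all add: Poly_Mapping.keys_add)
  show ?thesis
    using expr_val_symb_circ[OF K] expr_val_symb_circ[of ?K p] expr_val_symb_circ[of ?K q]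
    by (simp add: lookup_add distrib_left sum.distrib)
qed

lemma expr_val_symb_circ_sum:
  "expr_val n d f (symb X \<odot> (\<Sum>i\<in>I. p i)) = (\<Sum>i\<in>I. expr_val n d f (symb X \<odot> p i))"
proof (induction I rule: infinite_finite_induct)
  case (insert i I)
  then show ?case by (simp add: expr_val_symb_circ_add)
\<comment> \<open>For empty or infinite \<open>I\<close> the sum is 0, and \<open>circ\<close> with
  0 is an empty sum.\<close>
qed (simp_all add: circ_def)

lemma expr_val_symb_circ_wtutte_expr:
  "expr_val n d f (symb {s e} \<odot> wtutte_expr N s) =
    (\<Sum>A\<in>Pow (ground N). const (tilde n d f (s ` insert e A)) * tutte_coeff N A)"
  by (simp add: wtutte_expr_def expr_val_symb_circ_sum expr_val_symb_circ_single)

lemma wtutte_split: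
  assumes "finite (ground M)" "e \<in> ground M"
  shows "wtutte n d f M s =
    (\<Sum>A\<in>Pow (ground M - {e}). const (tilde n d f (s ` A)) * tutte_coeff M A)
    + (\<Sum>A\<in>Pow (ground M - {e}).
        const (tilde n d f (s ` insert e A)) * tutte_coeff M (insert e A))"
proof -
  let ?P = "Pow (ground M - {e})"
  have "Pow (ground M) = ?P \<union> insert e ` ?P"
    using assms(2) Pow_insert[of e "ground M - {e}"] by (simp add: insert_absorb)
  moreover have "?P \<inter> insert e ` ?P = {}" by auto
  moreover have "inj_on (insert e) ?P"
    \<comment> \<open>No member of \<open>?P\<close> contains \<open>e\<close>, so removing
      \<open>e\<close> undoes the insertion.\<close>
    by (rule inj_onI) (metis Diff_insert_absorb PowD insert_Diff_single subset_Diff_insert)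
  ultimately show ?thesis
    unfolding wtutte_def using assms(1)
    by (simp add: sum.union_disjoint sum.reindex)
qed

theorem proposition4p1:
  fixes M :: "'a matroid" and n d :: nat and f :: "nat set \<Rightarrow>\<^sub>0 real" and s :: "'a \<Rightarrow> nat"
  assumes "is_matroid M"
    and "card (ground M) = n"
    and "f \<in> Hom d n"
    and "bij_betw s (ground M) {1..n}"
  shows "wtutte n d f (empty_matroid :: 'a matroid) s = const (tilde n d f {})
    \<and> (\<forall>e\<in>ground M.
        (is_loop M e \<longrightarrow>
           wtutte n d f M s =
             wtutte n d f (deletion M e) s
             + (var_y - 1) * expr_val n d f (symb {s e} \<odot> wtutte_expr (deletion M e) s))
      \<and> (is_coloop M e \<longrightarrow>
           wtutte n d f M s =
             (var_x - 1) * wtutte n d f (contraction M e) s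
             + expr_val n d f (symb {s e} \<odot> wtutte_expr (contraction M e) s))
      \<and> (\<not> is_loop M e \<and> \<not> is_coloop M e \<longrightarrow>
           wtutte n d f M s =
             wtutte n d f (deletion M e) s
             + expr_val n d f (symb {s e} \<odot> wtutte_expr (contraction M e) s)))"
proof (intro conjI ballI impI)
  show "wtutte n d f (empty_matroid :: 'a matroid) s = const (tilde n d f {})"
  proof -
    \<comment> \<open>The only independent set is empty, so all ranks are 0 and the single
      coefficient is 1.\<close>
    have "{I::'a set. I = {} \<and> I \<subseteq> {}} = {{}}" by auto
    then show ?thesis
      by (simp add: wtutte_def tutte_coeff_def rank_def empty_matroid_def)
  qed
next
  fix e assume e: "e \<in> ground M"
  note split = wtutte_split[OF finite_ground[OF assms(1)] e]
  \<comment> \<open>These rewrites turn both sides into two sums over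
    \<open>Pow (ground M - {e})\<close>, one for \<open>A\<close> and one for
    \<open>insert e A\<close>, to be compared termwise.\<close>
  note expand = split expr_val_symb_circ_wtutte_expr wtutte_def[of _ _ _ "deletion M e"]
    wtutte_def[of _ _ _ "contraction M e"] sum_distrib_left
  {
    assume "is_loop M e"
    note coeff = tutte_coeff_deletion_loop[OF assms(1) this]
    show "wtutte n d f M s = wtutte n d f (deletion M e) s
        + (var_y - 1) * expr_val n d f (symb {s e} \<odot> wtutte_expr (deletion M e) s)"
      unfolding expand ground_deletion
      by (intro arg_cong2[of _ _ _ _ "(+)"] sum.cong refl)
        \<comment> \<open>Commutation moves the scalar factor past the weight
          \<open>const (tilde n d f _)\<close>.\<close>
        (simp_all only: coeff Pow_iff mult.left_commute)
  next
    assume "is_coloop M e"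
    note coeff = tutte_coeff_contraction_coloop[OF assms(1) this]
      tutte_coeff_insert_contraction[OF assms(1) e coloop_not_loop[OF assms(1) this]]
    show "wtutte n d f M s = (var_x - 1) * wtutte n d f (contraction M e) s
        + expr_val n d f (symb {s e} \<odot> wtutte_expr (contraction M e) s)"
      unfolding expand ground_contraction
      by (intro arg_cong2[of _ _ _ _ "(+)"] sum.cong refl)
        (simp_all only: coeff Pow_iff mult.left_commute)
  next
    assume "\<not> is_loop M e \<and> \<not> is_coloop M e"
    then have "\<not> is_loop M e" "\<not> is_coloop M e" by blast+
    note coeff = tutte_coeff_deletion_non_coloop[OF assms(1) e this(2)]
      tutte_coeff_insert_contraction[OF assms(1) e this(1)]
    show "wtutte n d f M s = wtutte n d f (deletion M e) s
        + expr_val n d f (symb {s e} \<odot> wtutte_expr (contraction M e) s)"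
      unfolding expand ground_deletion ground_contraction
      by (intro arg_cong2[of _ _ _ _ "(+)"] sum.cong refl)
        (simp_all only: coeff Pow_iff)
  }
qed

end
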